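(* There exists a compact Hausdorff space $K$ such that (1) $K$ contains no nontrivial convergent sequences but contains a topological copy of $\beta\mathbb{N}$, the Stone-Čech compactification of the discrete space $\mathbb{N}$; (2) the function space $C_p(K)$ has the Josefson-Nissenzweig property (JNP).
   Context: For a Tychonoff space $X$, $C_p(X)$ is the space of continuous real-valued functions on $X$ with the topology of pointwise convergence. A finitely supported sign-measure on $X$ is a finite linear combination $\mu=\sum_{x\in F}\alpha_x\delta_x$ of Dirac measures $\delta_x:f\mapsto f(x)$, where $F\subset X$ is finite and the $\alpha_x$ are non-zero reals; it acts on functions by $\mu(f)=\sum_{x\in F}\alpha_x f(x)$ and has norm $\|\mu\|=\sum_{x\in F}|\alpha_x|$. The space $C_p(X)$ satisfies the Josefson-Nissenzweig property (JNP) if there exists a sequence $(\mu_n)_{n\in\mathbb{N}}$ of finitely supported sign-measures on $X$ such that $\|\mu_n\|=1$ for all $n\in\mathbb{N}$ and $\mu_n(f)\to 0$ as $n\to\infty$ for every $f\in C_p(X)$. A convergent sequence is nontrivial if it has infinitely many distinct terms. *)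

theory Defs
  imports "HOL-Analysis.Analysis" "HOL-Library.Poly_Mapping"
begin

definition Cp :: "'a topology \<Rightarrow> ('a \<Rightarrow> real) topology" where
  "Cp X = subtopology (product_topology (\<lambda>_. euclideanreal) (topspace X))
            {f. continuous_map X euclideanreal f}"

(* The coefficients of a measure form a finitely supported function, whose keys are the
   points with non-zero coefficient. *)
definition sign_measures :: "'a topology \<Rightarrow> ('a \<Rightarrow>\<^sub>0 real) set" where
  "sign_measures X = {\<mu>. Poly_Mapping.keys \<mu> \<subseteq> topspace X}"

definition sm_apply :: "('a \<Rightarrow>\<^sub>0 real) \<Rightarrow> ('a \<Rightarrow> real) \<Rightarrow> real" where
  "sm_apply \<mu> f = (\<Sum>x\<in>Poly_Mapping.keys \<mu>. Poly_Mapping.lookup \<mu> x * f x)"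

definition sm_norm :: "('a \<Rightarrow>\<^sub>0 real) \<Rightarrow> real" where
  "sm_norm \<mu> = (\<Sum>x\<in>Poly_Mapping.keys \<mu>. \<bar>Poly_Mapping.lookup \<mu> x\<bar>)"

definition Cp_JNP :: "'a topology \<Rightarrow> bool" where
  "Cp_JNP X \<longleftrightarrow>
     (\<exists>\<mu> :: nat \<Rightarrow> ('a \<Rightarrow>\<^sub>0 real).
        (\<forall>n. \<mu> n \<in> sign_measures X \<and> sm_norm (\<mu> n) = 1) \<and>
        (\<forall>f \<in> topspace (Cp X). (\<lambda>n. sm_apply (\<mu> n) f) \<longlonglongrightarrow> 0))"

definition has_nontrivial_convergent_sequence :: "'a topology \<Rightarrow> bool" where
  "has_nontrivial_convergent_sequence X \<longleftrightarrow>
     (\<exists>(s :: nat \<Rightarrow> 'a) l. range s \<subseteq> topspace X \<and> infinite (range s) \<and>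
        limitin X s l sequentially)"

(* Continuous functions from X to the unit interval; extensionality makes two of them equal
   as soon as they agree on the points of X. *)
definition unit_functions :: "'a topology \<Rightarrow> ('a \<Rightarrow> real) set" where
  "unit_functions X =
     {f \<in> extensional (topspace X). continuous_map X (top_of_set {0..1}) f}"

definition evaluation_map :: "'a topology \<Rightarrow> 'a \<Rightarrow> (('a \<Rightarrow> real) \<Rightarrow> real)" where
  "evaluation_map X x = (\<lambda>f\<in>unit_functions X. f x)"

definition unit_cube :: "'a topology \<Rightarrow> (('a \<Rightarrow> real) \<Rightarrow> real) topology" where
  "unit_cube X = product_topology (\<lambda>_. top_of_set {0..1}) (unit_functions X)"

(* Closure of the canonical image of a Tychonoff space X in the cube with exponent C(X,[0,1]) *)
definition stone_cech :: "'a topology \<Rightarrow> (('a \<Rightarrow> real) \<Rightarrow> real) topology" where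
  "stone_cech X =
     subtopology (unit_cube X) (unit_cube X closure_of (evaluation_map X ` topspace X))"

abbreviation beta_nat :: "((nat \<Rightarrow> real) \<Rightarrow> real) topology" where
  "beta_nat \<equiv> stone_cech (discrete_topology (UNIV :: nat set))"

definition contains_copy_of :: "'a topology \<Rightarrow> 'b topology \<Rightarrow> bool" where
  "contains_copy_of X Y \<longleftrightarrow>
     (\<exists>S \<subseteq> topspace X. subtopology X S homeomorphic_space Y)"

end

theory Submission
  imports Defs "HOL-Real_Asymp.Real_Asymp"
begin

text \<open>
  The space is the one-point compactification of an open subset of the Stone-Cech
  compactification of the naturals. Let \<open>Z\<close> be the ideal of sets of natural numbers with
  asymptotic density zero, and let \<open>K\<close> consist of the ultrafilters that contain a member of \<open>Z\<close>,
  together with one further point \<open>\<infinity>\<close>. In other words, \<open>K\<close> is the Stone space of the Boolean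
  algebra of sets with density zero or one. Concretely, a point of \<open>K\<close> is a zero-one valued
  homomorphism on the ring \<open>Z\<close>, and \<open>\<infinity>\<close> is the zero homomorphism.

  Continuity at \<open>\<infinity>\<close> means convergence outside a set of density zero. Hence the averages
  of a continuous function over \<open>{0..n}\<close> converge to its value at \<open>\<infinity>\<close>, and the measures
  that are half the difference of the uniform measure on \<open>{0..n}\<close> and the Dirac measure at
  \<open>\<infinity>\<close> witness the JNP (\<open>test_measures_converge\<close>).

  There is no nontrivial convergent sequence. A limit other than \<open>\<infinity>\<close> is excluded as in
  \<open>\<beta>\<nat>\<close>: the terms are separated by disjoint clopen sets, and the union of every other one of
  the corresponding members of \<open>Z\<close> distinguishes the even terms from the odd ones
  (\<open>no_limit_inside\<close>). For the limit \<open>\<infinity>\<close> a single member of \<open>Z\<close> must be found that belongs to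
  infinitely many terms (\<open>no_limit_ideal_point\<close>). If infinitely many terms are principal, it exists
  because every infinite set has an infinite subset in \<open>Z\<close>. If almost all terms are nonprincipal,
  it exists because \<open>Z\<close> is a P-ideal: countably many members of \<open>Z\<close> are almost contained in one.

  Finally, the ultrafilters that contain one fixed infinite member of \<open>Z\<close>, here the set of
  squares, form a copy of \<open>\<beta>\<nat>\<close> (\<open>contains_beta_nat\<close>).
\<close>

section \<open>The ideal of sets of density zero\<close>

definition freq :: "nat \<Rightarrow> nat set \<Rightarrow> real" where
  "freq n A = card (A \<inter> {..n}) / Suc n"

definition density_zero :: "nat set \<Rightarrow> bool" where
  "density_zero A \<longleftrightarrow> (\<lambda>n. freq n A) \<longlonglongrightarrow> 0"

lemma freq_nonneg [simp]: "0 \<le> freq n A"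
  by (simp add: freq_def)

lemma freq_mono:
  assumes "A \<inter> {..n} \<subseteq> B" shows "freq n A \<le> freq n B"
  unfolding freq_def using assms
  by (intro divide_right_mono of_nat_mono card_mono) auto

lemma density_zero_dominated:
  assumes "u \<longlonglongrightarrow> 0" "eventually (\<lambda>n. freq n A \<le> u n) sequentially"
  shows "density_zero A"
  unfolding density_zero_def
  by (rule tendsto_sandwich[OF _ assms(2) tendsto_const assms(1)]) simp

lemma density_zero_subset:
  assumes "density_zero B" "A \<subseteq> B" shows "density_zero A"
  by (rule density_zero_dominated[OF assms(1)[unfolded density_zero_def]])
     (use assms(2) in \<open>auto intro!: freq_mono eventuallyI\<close>)

lemma density_zero_Un:
  assumes "density_zero A" "density_zero B" shows "density_zero (A \<union> B)"
proof (rule density_zero_dominated)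
  show "(\<lambda>n. freq n A + freq n B) \<longlonglongrightarrow> 0"
    using tendsto_add[OF assms[unfolded density_zero_def]] by simp
  show "eventually (\<lambda>n. freq n (A \<union> B) \<le> freq n A + freq n B) sequentially"
  proof (rule eventuallyI)
    fix n
    have "card ((A \<union> B) \<inter> {..n}) \<le> card (A \<inter> {..n}) + card (B \<inter> {..n})"
      by (metis Int_Un_distrib2 card_Un_le)
    then show "freq n (A \<union> B) \<le> freq n A + freq n B"
      unfolding freq_def add_divide_distrib[symmetric] of_nat_add[symmetric]
      by (intro divide_right_mono of_nat_mono) auto
  qed
qed

lemma density_zero_finite:
  assumes "finite A" shows "density_zero A"
proof (rule density_zero_dominated)
  show "(\<lambda>n. real (card A) / Suc n) \<longlonglongrightarrow> 0" by real_asymp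
  show "eventually (\<lambda>n. freq n A \<le> real (card A) / Suc n) sequentially"
    unfolding freq_def using assms
    by (intro eventuallyI divide_right_mono of_nat_mono card_mono) auto
qed

lemma density_zero_UN:
  assumes "finite I" "\<And>i. i \<in> I \<Longrightarrow> density_zero (A i)"
  shows "density_zero (\<Union>i\<in>I. A i)"
  using assms by (induction I rule: finite_induct) (auto simp: density_zero_finite density_zero_Un)

text \<open>
  At most \<open>sqrt n + 1\<close> of the values \<open>e j\<close> can lie below \<open>n\<close>.
\<close>
lemma density_zero_square_growth:
  assumes "\<And>j. j\<^sup>2 \<le> e j" shows "density_zero (range e)"
proof (rule density_zero_dominated)
  show "(\<lambda>n. (sqrt n + 1) / Suc n) \<longlonglongrightarrow> 0" by real_asymp
  show "eventually (\<lambda>n. freq n (range e) \<le> (sqrt n + 1) / Suc n) sequentially"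
  proof (rule eventuallyI)
    fix n
    have "range e \<inter> {..n} \<subseteq> e ` {..nat \<lfloor>sqrt n\<rfloor>}"
    proof
      fix x assume "x \<in> range e \<inter> {..n}"
      then obtain j where j: "x = e j" "e j \<le> n" by auto
      then have "real (j\<^sup>2) \<le> n"
        using assms[of j] by (intro of_nat_mono) linarith
      then have "real j \<le> sqrt n" by (simp add: real_le_rsqrt)
      then show "x \<in> e ` {..nat \<lfloor>sqrt n\<rfloor>}"
        using j by (auto simp: le_nat_floor)
    qed
    then have "card (range e \<inter> {..n}) \<le> nat \<lfloor>sqrt n\<rfloor> + 1"
      by (metis Suc_eq_plus1 card_atMost card_image_le card_mono finite_atMost finite_imageI le_trans)
    then have "real (card (range e \<inter> {..n})) \<le> real (nat \<lfloor>sqrt n\<rfloor>) + 1" by linarith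
    also have "\<dots> \<le> sqrt n + 1" by simp
    finally show "freq n (range e) \<le> (sqrt n + 1) / Suc n"
      unfolding freq_def by (intro divide_right_mono) auto
  qed
qed

lemma infinite_imp_density_zero_subset:
  fixes B :: "nat set"
  assumes "infinite B"
  obtains A where "A \<subseteq> B" "infinite A" "density_zero A"
proof
  define e where "e j = enumerate B (j\<^sup>2)" for j
  show "range e \<subseteq> B"
    using assms by (auto simp: e_def enumerate_in_set)
  have "inj e"
    by (rule injI) (metis assms e_def enumerate_mono less_irrefl linorder_neqE_nat
        power_strict_mono zero_le pos2)
  then show "infinite (range e)" by (simp add: finite_image_iff)
  show "density_zero (range e)"
    by (rule density_zero_square_growth) (use assms in \<open>auto simp: e_def intro: le_enumerate\<close>)
qed

text \<open>
  A subsequence that at each step waits for all delays \<open>N\<close> of the terms already chosen.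
\<close>
lemma fast_subsequence:
  fixes N :: "nat \<Rightarrow> nat"
  obtains r :: "nat \<Rightarrow> nat" where "strict_mono r" "\<And>i j. i < j \<Longrightarrow> N (r i) \<le> r j"
proof
  define r where "r = rec_nat 0 (\<lambda>_ k. Suc k + (\<Sum>i\<le>k. N i))"
  have Suc: "r (Suc j) = Suc (r j) + (\<Sum>i\<le>r j. N i)" for j by (simp add: r_def)
  show mono: "strict_mono r" by (rule strict_mono_Suc_iff[THEN iffD2]) (simp add: Suc)
  fix i j :: nat assume "i < j"
  have "N (r i) \<le> (\<Sum>k\<le>r i. N k)" by (rule member_le_sum) auto
  also have "\<dots> \<le> r (Suc i)" by (simp add: Suc)
  also have "\<dots> \<le> r j" using \<open>i < j\<close> mono by (simp add: strict_mono_less_eq)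
  finally show "N (r i) \<le> r j" .
qed

text \<open>
  A diagonal argument: delete from each \<open>A k\<close> an initial segment so long that from its end
  onwards the union of the sets up to \<open>A k\<close> has small density. The union of the truncated sets then still has density zero.
\<close>
lemma density_zero_P_ideal:
  fixes A :: "nat \<Rightarrow> nat set"
  assumes "\<And>k. density_zero (A k)"
  obtains B where "density_zero B" "\<And>k. finite (A k - B)"
proof -
  define U where "U k = (\<Union>i\<le>k. A i)" for k
  have "density_zero (U k)" for k
    unfolding U_def by (rule density_zero_UN) (auto simp: assms)
  then have "\<exists>M. \<forall>n\<ge>M. freq n (U k) < inverse (Suc k)" for k
    using order_tendstoD(2)[of "\<lambda>n. freq n (U k)" 0 sequentially "inverse (Suc k)"]
    by (simp add: density_zero_def eventually_sequentially del: of_nat_Suc)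
  then obtain M where M: "\<And>k n. M k \<le> n \<Longrightarrow> freq n (U k) < inverse (Suc k)" by metis
  define m where "m k = k + (\<Sum>i\<le>k. M i)" for k
  have M_le: "M k \<le> m k" for k
    unfolding m_def by (rule trans_le_add2, rule member_le_sum) auto
  have mono: "strict_mono m" by (rule strict_mono_Suc_iff[THEN iffD2]) (simp add: m_def)
  define B where "B = (\<Union>k. A k - {..m k})"
  have small: "freq n B \<le> inverse (Suc k)" if kn: "m k \<le> n" for k n
  proof -
    \<comment> \<open>the largest truncation bound not exceeding n: up to n, only the first sets contribute\<close>
    obtain l where l: "m l \<le> n" "n < m (Suc l)" "k \<le> l"
    proof -
      have "\<exists>l. n < m l" using strict_mono_imp_increasing[OF mono, of "Suc n"] by (intro exI[of _ "Suc n"]) linarith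
      define q where "q = (LEAST l. n < m l)"
      have q: "n < m q" unfolding q_def by (rule LeastI_ex) fact
      have "k < q" using q kn strict_mono_less[OF mono, of k q] strict_mono_less_eq[OF mono, of q k] by linarith
      then obtain l where "q = Suc l" by (cases q) auto
      have "m l \<le> n" using not_less_Least[of l "\<lambda>l. n < m l"] \<open>q = Suc l\<close> q_def by auto
      then show ?thesis using that[of l] q \<open>q = Suc l\<close> \<open>k < q\<close> by auto
    qed
    have "B \<inter> {..n} \<subseteq> U l"
    proof
      fix x assume "x \<in> B \<inter> {..n}"
      then obtain i where i: "x \<in> A i" "m i < x" "x \<le> n" by (auto simp: B_def)
      then have "m i < m (Suc l)" using l by linarith
      then have "i \<le> l" using mono by (simp add: strict_mono_less)
      then show "x \<in> U l" using i by (auto simp: U_def)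
    qed
    then have "freq n B \<le> freq n (U l)" by (rule freq_mono)
    also have "\<dots> < inverse (Suc l)" using l M_le[of l] by (intro M) linarith
    also have "\<dots> \<le> inverse (Suc k)" using l by (simp add: le_imp_inverse_le)
    finally show ?thesis by simp
  qed
  have "density_zero B"
    unfolding density_zero_def
  proof (rule LIMSEQ_I)
    fix e :: real assume "0 < e"
    then obtain k where "inverse (Suc k) < e" using reals_Archimedean by blast
    then show "\<exists>no. \<forall>n\<ge>no. norm (freq n B - 0) < e"
      using small by (intro exI[of _ "m k"]) (auto intro: le_less_trans)
  qed
  moreover have "finite (A k - B)" for k
    by (rule finite_subset[of _ "{..m k}"]) (auto simp: B_def)
  ultimately show ?thesis by (rule that)
qed

section \<open>The compactification\<close>

text \<open>
  The points are indexed by all functions on the naturals, although only the indicators of sets of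
  density zero carry information: this is the ring of such sets in disguise, with every other
  coordinate fixed at zero. The principal ultrafilter at \<open>n\<close> becomes evaluation at \<open>n\<close>.
\<close>
definition point :: "nat \<Rightarrow> (nat \<Rightarrow> real) \<Rightarrow> real" where
  "point n = (\<lambda>f. if \<exists>A. density_zero A \<and> f = indicator A then f n else 0)"

definition ideal_point :: "(nat \<Rightarrow> real) \<Rightarrow> real" where
  "ideal_point = (\<lambda>_. 0)"

definition compactification :: "((nat \<Rightarrow> real) \<Rightarrow> real) set" where
  "compactification = closure (insert ideal_point (range point))"

lemma ideal_point_apply [simp]: "ideal_point f = 0"
  by (simp add: ideal_point_def)

lemma point_indicator [simp]: "density_zero A \<Longrightarrow> point n (indicator A) = indicator A n"
  by (auto simp: point_def)

lemma point_eq_iff [simp]: "point m = point n \<longleftrightarrow> m = n"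
proof
  assume "point m = point n"
  then have "point m (indicator {m}) = point n (indicator {m})" by simp
  then show "m = n" by (simp add: density_zero_finite indicator_def split: if_splits)
qed simp

lemma point_neq_ideal_point [simp]: "point n \<noteq> ideal_point"
proof
  assume "point n = ideal_point"
  then have "point n (indicator {n}) = ideal_point (indicator {n})" by simp
  then show False by (simp add: density_zero_finite)
qed

lemma point_in [simp]: "point n \<in> compactification"
  and ideal_point_in [simp]: "ideal_point \<in> compactification"
  using closure_subset[of "insert ideal_point (range point)"] by (auto simp: compactification_def)

text \<open>
  All properties of points below are closed conditions on finitely many coordinates, or
  intersections of such conditions, so that they need only be checked on the defining dense set.
\<close>
lemma compactification_induct:
  assumes "p \<in> compactification" "closed {p. P p}" "P ideal_point" "\<And>n. P (point n)"
  shows "P p"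
proof -
  have "compactification \<subseteq> {p. P p}"
    unfolding compactification_def by (rule closure_minimal) (use assms in auto)
  then show ?thesis using assms by auto
qed

lemma two_valued:
  assumes "p \<in> compactification" shows "p f = 0 \<or> p f = 1"
  by (rule compactification_induct[OF assms])
     (auto simp: point_def indicator_def intro!: closed_Collect_disj closed_Collect_eq continuous_intros)

lemma vanishes_outside:
  assumes "p \<in> compactification" "\<nexists>A. density_zero A \<and> f = indicator A"
  shows "p f = 0"
  by (rule compactification_induct[OF assms(1)])
     (use assms(2) in \<open>auto simp: point_def intro!: closed_Collect_eq continuous_intros\<close>)

lemma value_Int:
  assumes "p \<in> compactification" "density_zero A" "density_zero B"
  shows "p (indicator (A \<inter> B)) = p (indicator A) * p (indicator B)"
proof (rule compactification_induct[OF assms(1)])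
  have "density_zero (A \<inter> B)" using assms(2) by (rule density_zero_subset) simp
  then show "point n (indicator (A \<inter> B)) = point n (indicator A) * point n (indicator B)" for n
    by (subst (1 2 3) point_indicator) (use assms in \<open>auto split: split_indicator\<close>)
qed (auto intro!: closed_Collect_eq continuous_intros simp del: indicator_inter_arith)

lemma value_Un:
  assumes "p \<in> compactification" "density_zero A" "density_zero B"
  shows "p (indicator (A \<union> B)) = max (p (indicator A)) (p (indicator B))"
proof (rule compactification_induct[OF assms(1)])
  have "density_zero (A \<union> B)" using assms(2,3) by (rule density_zero_Un)
  then show "point n (indicator (A \<union> B)) = max (point n (indicator A)) (point n (indicator B))" for n
    by (subst (1 2 3) point_indicator) (use assms in \<open>auto split: split_indicator\<close>)
qed (auto intro!: closed_Collect_eq continuous_intros)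

lemma value_empty:
  assumes "p \<in> compactification" shows "p (indicator {}) = 0"
proof (rule compactification_induct[OF assms])
  show "point n (indicator {}) = 0" for n
    by (subst point_indicator) (simp_all add: density_zero_finite)
qed (auto intro!: closed_Collect_eq continuous_intros)

text \<open>
  The principal ultrafilters are isolated points: the coordinate of \<open>{k}\<close> decides all others.
\<close>
lemma value_singleton:
  assumes "p \<in> compactification" "p (indicator {k}) = 1" shows "p = point k"
proof
  fix f
  have "p (indicator {k}) = 0 \<or> p f = point k f"
  proof (rule compactification_induct[OF assms(1)])
    show "point n (indicator {k}) = 0 \<or> point n f = point k f" for n
      by (subst point_indicator) (simp_all add: density_zero_finite indicator_def)
  qed (auto intro!: closed_Collect_disj closed_Collect_eq continuous_intros)
  then show "p f = point k f" using assms by simp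
qed

lemma value_mono:
  assumes "p \<in> compactification" "density_zero B" "A \<subseteq> B" "p (indicator A) = 1"
  shows "p (indicator B) = 1"
proof -
  have "p (indicator (A \<inter> B)) = p (indicator A) * p (indicator B)"
    using assms(3) by (intro value_Int[OF assms(1) _ assms(2)] density_zero_subset[OF assms(2)])
  then show ?thesis using assms(3,4) by (simp add: Int_absorb2)
qed

lemma value_disjoint:
  assumes "p \<in> compactification" "density_zero A" "density_zero B" "A \<inter> B = {}"
    "p (indicator A) = 1"
  shows "p (indicator B) = 0"
  using value_Int[OF assms(1-3)] value_empty[OF assms(1)] assms(4,5) by simp

lemma value_Diff:
  assumes "p \<in> compactification" "density_zero A" "density_zero B"
    "p (indicator A) = 1" "p (indicator B) = 0"
  shows "p (indicator (A - B)) = 1"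
proof -
  have "p (indicator ((A - B) \<union> B)) = max (p (indicator (A - B))) (p (indicator B))"
    by (intro value_Un[OF assms(1) _ assms(3)] density_zero_subset[OF assms(2)]) simp
  moreover have "p (indicator ((A - B) \<union> B)) = 1"
    by (rule value_mono[OF assms(1) density_zero_Un _ assms(4)])
      (use assms density_zero_subset[OF assms(2), of "A - B"] in auto)
  ultimately show ?thesis using assms(5) by (simp add: max_def split: if_splits)
qed

lemma value_UN:
  assumes "p \<in> compactification" "finite I" "\<And>i. i \<in> I \<Longrightarrow> density_zero (A i)"
    "\<And>i. i \<in> I \<Longrightarrow> p (indicator (A i)) = 0"
  shows "p (indicator (\<Union>i\<in>I. A i)) = 0"
  using assms(2-4)
proof (induction I rule: finite_induct)
  case (insert i I)
  then show ?case using value_Un[OF assms(1), of "A i" "\<Union>i\<in>I. A i"]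
    by (simp add: density_zero_UN)
qed (simp add: value_empty[OF assms(1)])

lemma value_finite:
  assumes "p \<in> compactification" "\<And>k. p \<noteq> point k" "finite A"
  shows "p (indicator A) = 0"
proof -
  have "p (indicator {k}) = 0" for k
    using two_valued[OF assms(1)] value_singleton[OF assms(1)] assms(2) by metis
  then have "p (indicator (\<Union>k\<in>A. {k})) = 0"
    using assms by (intro value_UN[OF assms(1,3)]) (auto simp: density_zero_finite)
  then show ?thesis by simp
qed

lemma obtain_member:
  assumes "p \<in> compactification" "p \<noteq> ideal_point"
  obtains A where "density_zero A" "p (indicator A) = 1"
proof -
  obtain f where "p f \<noteq> 0" using assms(2) by (auto simp: ideal_point_def)
  then show ?thesis
    using that two_valued[OF assms(1), of f] vanishes_outside[OF assms(1), of f] by metis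
qed

lemma obtain_separating:
  assumes "p \<in> compactification" "q \<in> compactification" "p \<noteq> q"
  obtains A where "density_zero A" "p (indicator A) \<noteq> q (indicator A)"
proof -
  obtain f where "p f \<noteq> q f" using assms(3) by auto
  then show ?thesis
    using that vanishes_outside[OF assms(1), of f] vanishes_outside[OF assms(2), of f] by metis
qed

lemma compact_compactification: "compact compactification"
proof -
  let ?C = "PiE UNIV (\<lambda>_. {0..1::real}) :: ((nat \<Rightarrow> real) \<Rightarrow> real) set"
  have "compactin (product_topology (\<lambda>_. euclideanreal) UNIV) ?C"
    by (subst compactin_PiE) auto
  then have "compact ?C" by (simp add: euclidean_product_topology)
  moreover have "compactification \<subseteq> ?C"
  proof
    fix p assume "p \<in> compactification"
    then have "p f \<in> {0..1}" for f using two_valued[of p f] by auto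
    then show "p \<in> ?C" by auto
  qed
  ultimately show ?thesis
    using compact_Int_closed[of ?C compactification]
    by (simp add: compactification_def inf_absorb2)
qed

lemma Hausdorff_compactification: "Hausdorff_space (top_of_set compactification)"
proof -
  have "Hausdorff_space (product_topology (\<lambda>_. euclideanreal) (UNIV :: (nat \<Rightarrow> real) set))"
    by (simp add: Hausdorff_space_product_topology)
  then show ?thesis
    by (simp add: euclidean_product_topology Hausdorff_space_subtopology)
qed

section \<open>Absence of convergent sequences\<close>

text \<open>
  Coordinates take the values zero and one only, so that they stabilise along convergent sequences.
\<close>
lemma limit_eventually_value:
  assumes s: "limitin (top_of_set compactification) s l sequentially"
    and "\<And>n. s n \<in> compactification"
  shows "eventually (\<lambda>n. s n f = l f) sequentially"
proof -
  have l: "l \<in> compactification" and "limitin euclidean s l sequentially"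
    using s by (auto simp: limitin_subtopology)
  then have "limitin (product_topology (\<lambda>_. euclideanreal) UNIV) s l sequentially"
    by (simp add: euclidean_product_topology)
  then have "(\<lambda>n. s n f) \<longlonglongrightarrow> l f"
    by (auto simp: limitin_componentwise)
  then have "eventually (\<lambda>n. dist (s n f) (l f) < 1) sequentially"
    by (rule tendstoD) simp
  then show ?thesis
  proof (rule eventually_mono)
    fix n assume "dist (s n f) (l f) < 1"
    then show "s n f = l f"
      using two_valued[OF l, of f] two_valued[OF assms(2), of n f] by (auto simp: dist_real_def)
  qed
qed

text \<open>
  The limit contains a set \<open>A\<close> of density zero, and inside \<open>A\<close> every subset has density zero.
  Thus arbitrary unions of subsets of \<open>A\<close> are available, and a union that contains every other
  term of a subsequence, and omits the rest, contradicts convergence.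
\<close>
lemma no_limit_inside:
  assumes t: "\<And>n. t n \<in> compactification" and l: "l \<in> compactification" "l \<noteq> ideal_point"
    and neq: "\<And>n. t n \<noteq> l"
    and conv: "\<And>A. density_zero A \<Longrightarrow>
      eventually (\<lambda>n. t n (indicator A) = l (indicator A)) sequentially"
  shows False
proof -
  obtain A where A: "density_zero A" "l (indicator A) = 1" using obtain_member[OF l] .
  obtain n0 where n0: "\<And>n. n0 \<le> n \<Longrightarrow> t n (indicator A) = 1"
    using conv[OF A(1)] A(2) by (auto simp: eventually_sequentially)
  define u where "u n = t (n + n0)" for n
  have u: "u n \<in> compactification" "u n (indicator A) = 1" for n
    using t n0 by (auto simp: u_def)
  have conv_u: "eventually (\<lambda>n. u n (indicator B) = l (indicator B)) sequentially" if "density_zero B" for B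
    unfolding u_def using conv[OF that] by (rule sequentially_offset)
  \<comment> \<open>the trace on A of a separating set, or of its complement, contains the term but not the limit\<close>
  have "\<exists>C. C \<subseteq> A \<and> u n (indicator C) = 1 \<and> l (indicator C) = 0" for n
  proof -
    obtain C where C: "density_zero C" "u n (indicator C) \<noteq> l (indicator C)"
      using obtain_separating[OF u(1) l(1)] neq[of "n + n0"] by (metis u_def)
    consider "u n (indicator C) = 1" "l (indicator C) = 0" | "u n (indicator C) = 0" "l (indicator C) = 1"
      using C(2) two_valued[OF u(1)] two_valued[OF l(1)] by metis
    then show ?thesis
    proof cases
      case 1
      then show ?thesis using value_Int[OF u(1) A(1) C(1), of n] value_Int[OF l(1) A(1) C(1)] u A
        by (intro exI[of _ "A \<inter> C"]) auto
    next
      case 2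
      have "l (indicator (A - C)) = 0"
        by (rule value_disjoint[OF l(1) C(1)]) (use 2 density_zero_subset[OF A(1)] in auto)
      moreover have "u n (indicator (A - C)) = 1"
        by (rule value_Diff[OF u(1)]) (use u A C 2 in auto)
      ultimately show ?thesis by (intro exI[of _ "A - C"]) auto
    qed
  qed
  then obtain C where C: "\<And>n. C n \<subseteq> A" "\<And>n. u n (indicator (C n)) = 1" "\<And>n. l (indicator (C n)) = 0"
    by metis
  have dC: "density_zero B" if "B \<subseteq> A" for B
    using that A(1) by (rule density_zero_subset[rotated])
  have "\<exists>N. \<forall>n\<ge>N. u n (indicator (C i)) = 0" for i
    using conv_u[OF dC[OF C(1)], of i] C(3) by (simp add: eventually_sequentially)
  then obtain N where N: "\<And>i n. N i \<le> n \<Longrightarrow> u n (indicator (C i)) = 0" by metis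
  obtain r :: "nat \<Rightarrow> nat" where r: "strict_mono r" "\<And>i j. i < j \<Longrightarrow> N (r i) \<le> r j"
    using fast_subsequence[of N] by blast
  \<comment> \<open>along the subsequence, term j avoids the sets of the earlier terms, so the sets become disjoint\<close>
  define D where "D j = C (r j) - (\<Union>i<j. C (r i))" for j
  have DA: "D j \<subseteq> A" for j using C by (auto simp: D_def)
  have uD: "u (r j) (indicator (D j)) = 1" for j
    unfolding D_def
  proof (rule value_Diff[OF u(1)])
    show "u (r j) (indicator (\<Union>i<j. C (r i))) = 0"
      by (rule value_UN[OF u(1)]) (use C dC N r(2) in auto)
  qed (use u C dC density_zero_UN[of "{..<j}" "\<lambda>i. C (r i)"] in auto)
  have disj: "D i \<inter> D j = {}" if "i < j" for i j using that by (auto simp: D_def)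
  define B where "B = (\<Union>j. D (2 * j))"
  have BA: "B \<subseteq> A" using DA by (auto simp: B_def)
  have "u (r (2 * j)) (indicator B) = 1" for j
    by (rule value_mono[OF u(1) dC[OF BA] _ uD]) (auto simp: B_def)
  moreover have "u (r (2 * j + 1)) (indicator B) = 0" for j
  proof (rule value_disjoint[OF u(1) dC[OF DA] dC[OF BA] _ uD])
    have "D (2 * j + 1) \<inter> D (2 * i) = {}" for i
    proof (cases "i \<le> j")
      case True
      then show ?thesis using disj[of "2 * i" "2 * j + 1"] by (simp add: Int_commute)
    next
      case False
      then show ?thesis by (intro disj) simp
    qed
    then show "D (2 * j + 1) \<inter> B = {}" by (auto simp: B_def)
  qed
  moreover obtain M where "\<And>n. M \<le> n \<Longrightarrow> u n (indicator B) = l (indicator B)"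
    using conv_u[OF dC[OF BA]] by (auto simp: eventually_sequentially)
  moreover have "M \<le> r (2 * M)" "M \<le> r (2 * M + 1)"
    using strict_mono_imp_increasing[OF r(1), of "2 * M"]
      strict_mono_imp_increasing[OF r(1), of "2 * M + 1"] by linarith+
  ultimately show False by (metis zero_neq_one)
qed

text \<open>
  A sequence converges to the point at infinity only if it leaves every set of density zero. Either
  infinitely many terms are principal, and a sparse infinite set of them is not left, or almost all
  are nonprincipal, and a set of density zero that almost contains a member of each term is not left.
\<close>
lemma no_limit_ideal_point:
  assumes t: "\<And>n. t n \<in> compactification" and inj: "inj t"
    and neq: "\<And>n. t n \<noteq> ideal_point"
    and conv: "\<And>A. density_zero A \<Longrightarrow>
      eventually (\<lambda>n. t n (indicator A) = 0) sequentially"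
  shows False
proof (cases "infinite {k. point k \<in> range t}")
  case True
  then obtain A where A: "A \<subseteq> {k. point k \<in> range t}" "infinite A" "density_zero A"
    by (rule infinite_imp_density_zero_subset)
  obtain N where N: "\<And>n. N \<le> n \<Longrightarrow> t n (indicator A) = 0"
    using conv[OF A(3)] by (auto simp: eventually_sequentially)
  have "point ` A \<subseteq> t ` {..<N}"
  proof
    fix p assume "p \<in> point ` A"
    then obtain k where "k \<in> A" "p = point k" by auto
    moreover then obtain n where "point k = t n" using A(1) by auto
    ultimately have "p = t n" "t n = point k" "k \<in> A" by simp_all
    then have "\<not> N \<le> n" using N[of n] A(3) by auto
    then show "p \<in> t ` {..<N}" using \<open>p = t n\<close> by auto
  qed
  then have "finite (point ` A)" by (rule finite_subset) simp
  moreover have "inj_on point A" by (auto intro: inj_onI)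
  ultimately show False using A(2) by (simp add: finite_image_iff)
next
  case False
  have "\<exists>A. density_zero A \<and> t n (indicator A) = 1" for n
    using obtain_member[OF t neq] by metis
  then obtain A where A: "\<And>n. density_zero (A n)" "\<And>n. t n (indicator (A n)) = 1" by metis
  obtain B where B: "density_zero B" "\<And>n. finite (A n - B)"
    using density_zero_P_ideal[of A, OF A(1)] by metis
  have "{n. t n (indicator B) \<noteq> 0} \<supseteq> {n. \<forall>k. t n \<noteq> point k}"
  proof (clarsimp, rule ccontr)
    fix n assume n: "\<forall>k. t n \<noteq> point k" "t n (indicator B) = 0"
    have "t n (indicator (A n - B)) = 1" by (rule value_Diff[OF t]) (use A B n in auto)
    moreover have "t n (indicator (A n - B)) = 0" by (rule value_finite[OF t]) (use B n in auto)
    ultimately show False by simp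
  qed
  moreover have "finite {n. t n (indicator B) \<noteq> 0}"
    using conv[OF B(1)] by (simp add: eventually_cofinite cofinite_eq_sequentially[symmetric])
  ultimately have "finite {n. \<forall>k. t n \<noteq> point k}" using finite_subset by blast
  moreover have "finite {n. \<exists>k. t n = point k}"
  proof (rule finite_imageD)
    show "inj_on t {n. \<exists>k. t n = point k}" using inj by (rule inj_on_subset) simp
    have "t ` {n. \<exists>k. t n = point k} \<subseteq> point ` {k. point k \<in> range t}"
    proof
      fix p assume "p \<in> t ` {n. \<exists>k. t n = point k}"
      then obtain n k where "p = t n" "t n = point k" by auto
      moreover then have "point k \<in> range t" by (metis rangeI)
      ultimately show "p \<in> point ` {k. point k \<in> range t}" by simp
    qed
    then show "finite (t ` {n. \<exists>k. t n = point k})" using False finite_subset by blast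
  qed
  ultimately have "finite ({n. \<forall>k. t n \<noteq> point k} \<union> {n. \<exists>k. t n = point k})" by simp
  moreover have "{n. \<forall>k. t n \<noteq> point k} \<union> {n. \<exists>k. t n = point k} = UNIV" by auto
  ultimately show False by simp
qed

text \<open>
  Choosing one index for each value other than \<open>l\<close> and listing these indices in increasing order.
\<close>
lemma infinite_range_injective_subsequence:
  fixes s :: "nat \<Rightarrow> 'a"
  assumes "infinite (range s)"
  obtains r :: "nat \<Rightarrow> nat" where "strict_mono r" "inj (s \<circ> r)" "\<And>n. s (r n) \<noteq> l"
proof -
  define F where "F = inv s ` (range s - {l})"
  have inv: "s (inv s x) = x" if "x \<in> range s" for x using that by (rule f_inv_into_f)
  have "inj_on (inv s) (range s - {l})" by (rule inj_on_inverseI[of _ s]) (simp add: inv)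
  then have inf: "infinite F" using assms by (simp add: F_def finite_image_iff)
  have "inj_on s F" by (rule inj_onI) (auto simp: F_def inv)
  then have "inj (s \<circ> enumerate F)"
    using inf by (intro comp_inj_on) (auto simp: range_enumerate strict_mono_enumerate strict_mono_imp_inj_on)
  moreover have "s n \<noteq> l" if "n \<in> F" for n using that by (auto simp: F_def inv)
  ultimately show ?thesis
    using inf by (intro that[of "enumerate F"]) (auto simp: strict_mono_enumerate enumerate_in_set)
qed

lemma no_convergent_sequence:
  "\<not> has_nontrivial_convergent_sequence (top_of_set compactification)"
proof
  assume "has_nontrivial_convergent_sequence (top_of_set compactification)"
  then obtain s l where s: "range s \<subseteq> compactification" "infinite (range s)"
    and lim: "limitin (top_of_set compactification) s l sequentially"
    by (auto simp: has_nontrivial_convergent_sequence_def)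
  have l: "l \<in> compactification" using limitin_topspace[OF lim] by simp
  obtain r :: "nat \<Rightarrow> nat" where r: "strict_mono r" "inj (s \<circ> r)" "\<And>n. s (r n) \<noteq> l"
    using infinite_range_injective_subsequence[OF s(2), of l] by blast
  have conv: "eventually (\<lambda>n. s (r n) f = l f) sequentially" for f
    using s(1) by (intro eventually_subseq[OF r(1)] limit_eventually_value[OF lim]) auto
  show False
  proof (cases "l = ideal_point")
    case True
    show False by (rule no_limit_ideal_point[of "s \<circ> r"]) (use s r conv True in auto)
  next
    case False
    show False by (rule no_limit_inside[of "s \<circ> r" l]) (use s r conv l False in auto)
  qed
qed

section \<open>The copy of the Stone-Cech compactification of the naturals\<close>

lemma compact_beta_nat: "compact_space beta_nat"
proof -
  have "compact_space (unit_cube (discrete_topology (UNIV :: nat set)))"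
    unfolding unit_cube_def
    by (simp add: compact_space_product_topology compact_space_subtopology)
  then show ?thesis
    unfolding stone_cech_def
    by (intro compact_space_subtopology closedin_compact_space closedin_closure_of)
qed

lemma unit_functions_nat: "unit_functions (discrete_topology (UNIV :: nat set)) = {f. range f \<subseteq> {0..1}}"
  by (auto simp: unit_functions_def)

abbreviation eval_nat :: "nat \<Rightarrow> (nat \<Rightarrow> real) \<Rightarrow> real" where
  "eval_nat \<equiv> evaluation_map (discrete_topology (UNIV :: nat set))"

lemma continuous_beta_nat_projection:
  assumes "range f \<subseteq> {0..1}"
  shows "continuous_map beta_nat euclideanreal (\<lambda>p. p f)"
proof -
  have "continuous_map (unit_cube (discrete_topology UNIV)) (top_of_set {0..1}) (\<lambda>p. p f)"
    unfolding unit_cube_def using assms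
    by (intro continuous_map_product_projection) (simp add: unit_functions_nat)
  then show ?thesis
    unfolding stone_cech_def
    by (intro continuous_map_from_subtopology) (rule continuous_map_into_fulltopology)
qed

lemma eval_nat_apply: "range f \<subseteq> {0..1} \<Longrightarrow> eval_nat n f = f n"
  by (simp add: evaluation_map_def unit_functions_nat)

text \<open>
  Density of the naturals in their Stone-Cech compactification, as a proof principle.
\<close>
lemma beta_nat_induct:
  assumes "p \<in> topspace beta_nat" "closedin beta_nat {p \<in> topspace beta_nat. P p}"
    "\<And>n. P (eval_nat n)"
  shows "P p"
proof -
  let ?C = "unit_cube (discrete_topology (UNIV :: nat set))"
  let ?E = "range eval_nat"
  have E: "eval_nat n \<in> topspace ?C" for n
    by (auto simp: unit_cube_def evaluation_map_def unit_functions_nat)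
  have "p \<in> ?C closure_of ?E" using assms(1) by (simp add: stone_cech_def)
  moreover have "?C closure_of ?E \<subseteq> {p \<in> topspace beta_nat. P p}"
  proof (rule closure_of_minimal)
    show "?E \<subseteq> {p \<in> topspace beta_nat. P p}"
      using closure_of_subset[of ?E ?C] E assms(3) by (auto simp: stone_cech_def)
    show "closedin ?C {p \<in> topspace beta_nat. P p}"
      using assms(2) unfolding stone_cech_def
      by (rule closedin_trans_full) (rule closedin_closure_of)
  qed
  ultimately show ?thesis by auto
qed

text \<open>
  If \<open>p f < t < q f\<close>, then the set of \<open>k\<close> with \<open>f k < t\<close> belongs to the ultrafilter \<open>p\<close>
  but not to \<open>q\<close>.
\<close>
lemma beta_nat_eqI:
  assumes p: "p \<in> topspace beta_nat" and q: "q \<in> topspace beta_nat"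
    and eq: "\<And>C. p (indicator C) = q (indicator C)"
  shows "p = q"
proof (rule ccontr)
  assume "p \<noteq> q"
  have ind: "range (indicator C :: nat \<Rightarrow> real) \<subseteq> {0..1}" for C by (auto simp: indicator_def)
  have below: "r (indicator {k. f k < t}) = 0 \<or> r f \<le> t"
    and above: "r (indicator {k. f k < t}) = 1 \<or> t \<le> r f"
    if r: "r \<in> topspace beta_nat" and f: "range f \<subseteq> {0..1}" for r f t
  proof -
    let ?I = "indicator {k. f k < t} :: nat \<Rightarrow> real"
    show "r ?I = 0 \<or> r f \<le> t"
    proof (rule beta_nat_induct[OF r])
      have "{p \<in> topspace beta_nat. p ?I = 0 \<or> p f \<le> t} =
        {p \<in> topspace beta_nat. p ?I \<in> {0}} \<union> {p \<in> topspace beta_nat. p f \<in> {..t}}" by auto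
      then show "closedin beta_nat {p \<in> topspace beta_nat. p ?I = 0 \<or> p f \<le> t}"
        by (simp only:) (intro closedin_Un closedin_continuous_map_preimage[of _ euclideanreal]
          continuous_beta_nat_projection ind f; simp)
    qed (auto simp: eval_nat_apply[OF ind] eval_nat_apply[OF f] split: split_indicator)
    show "r ?I = 1 \<or> t \<le> r f"
    proof (rule beta_nat_induct[OF r])
      have "{p \<in> topspace beta_nat. p ?I = 1 \<or> t \<le> p f} =
        {p \<in> topspace beta_nat. p ?I \<in> {1}} \<union> {p \<in> topspace beta_nat. p f \<in> {t..}}" by auto
      then show "closedin beta_nat {p \<in> topspace beta_nat. p ?I = 1 \<or> t \<le> p f}"
        by (simp only:) (intro closedin_Un closedin_continuous_map_preimage[of _ euclideanreal]
          continuous_beta_nat_projection ind f; simp)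
    qed (auto simp: eval_nat_apply[OF ind] eval_nat_apply[OF f] split: split_indicator)
  qed
  have no_less: False
    if "r \<in> topspace beta_nat" "s \<in> topspace beta_nat" "\<And>C. r (indicator C) = s (indicator C)"
      "range f \<subseteq> {0..1}" "r f < s f" for r s f
  proof -
    obtain t where "r f < t" "t < s f" using dense \<open>r f < s f\<close> by blast
    then show False using above[OF that(1,4), of t] below[OF that(2,4), of t] that(3)[of "{k. f k < t}"] by auto
  qed
  obtain f where f: "p f \<noteq> q f" using \<open>p \<noteq> q\<close> by auto
  have "range f \<subseteq> {0..1}"
  proof (rule ccontr)
    assume "\<not> range f \<subseteq> {0..1}"
    then have "f \<notin> unit_functions (discrete_topology (UNIV :: nat set))" by (simp add: unit_functions_nat)
    then have "p f = undefined" "q f = undefined"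
      using p q by (auto simp: stone_cech_def unit_cube_def PiE_def extensional_def)
    then show False using f by simp
  qed
  then show False using no_less[OF p q eq, of f] no_less[OF q p eq[symmetric], of f] f by linarith
qed

text \<open>
  The embedding pushes ultrafilters forward along \<open>j \<mapsto> j\<^sup>2\<close>, whose range has density zero.
  As every set of naturals is the preimage of a set of squares, which has density zero, the
  coordinates in the ring determine all values on indicators, hence the ultrafilter.
\<close>
lemma contains_beta_nat: "contains_copy_of (top_of_set compactification) beta_nat"
proof -
  define e where "e j = j\<^sup>2" for j :: nat
  have e: "inj e" by (rule injI) (simp add: e_def)
  have de: "density_zero (e ` C)" for C
  proof (rule density_zero_subset)
    show "density_zero (range e)" by (rule density_zero_square_growth) (simp add: e_def)
  qed auto
  define \<Phi> where "\<Phi> p = (\<lambda>f. if \<exists>A. density_zero A \<and> f = indicator A then p (f \<circ> e) else 0)"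
    for p :: "(nat \<Rightarrow> real) \<Rightarrow> real"
  have cont: "continuous_map beta_nat euclidean \<Phi>"
    unfolding euclidean_product_topology[symmetric] continuous_map_componentwise_UNIV
  proof
    fix f :: "nat \<Rightarrow> real"
    show "continuous_map beta_nat euclideanreal (\<lambda>p. \<Phi> p f)"
    proof (cases "\<exists>A. density_zero A \<and> f = indicator A")
      case True
      then have "range (f \<circ> e) \<subseteq> {0..1}" by (auto simp: indicator_def)
      then show ?thesis using True by (simp add: \<Phi>_def continuous_beta_nat_projection)
    next
      case False
      then show ?thesis unfolding \<Phi>_def by (simp only: if_False) simp
    qed
  qed
  have "\<Phi> p \<in> compactification" if "p \<in> topspace beta_nat" for p
  proof (rule beta_nat_induct[OF that])
    show "closedin beta_nat {p \<in> topspace beta_nat. \<Phi> p \<in> compactification}"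
      by (rule closedin_continuous_map_preimage[OF cont]) (simp add: compactification_def)
    fix n
    have "\<Phi> (eval_nat n) = point (e n)"
    proof
      fix f
      show "\<Phi> (eval_nat n) f = point (e n) f"
      proof (cases "\<exists>A. density_zero A \<and> f = indicator A")
        case True
        then have "range (f \<circ> e) \<subseteq> {0..1}" by (auto simp: indicator_def)
        then show ?thesis using True by (simp add: \<Phi>_def point_def eval_nat_apply)
      next
        case False
        then show ?thesis by (simp only: \<Phi>_def point_def if_False)
      qed
    qed
    then show "\<Phi> (eval_nat n) \<in> compactification" by simp
  qed
  then have cont': "continuous_map beta_nat (top_of_set compactification) \<Phi>"
    using cont by (auto simp: continuous_map_in_subtopology)
  have "inj_on \<Phi> (topspace beta_nat)"
  proof (rule inj_onI)
    fix p q assume pq: "p \<in> topspace beta_nat" "q \<in> topspace beta_nat" "\<Phi> p = \<Phi> q"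
    have "\<Phi> p (indicator (e ` C)) = p (indicator C)" for p C
    proof -
      have "indicator (e ` C) \<circ> e = (indicator C :: nat \<Rightarrow> real)"
        using e by (auto simp: fun_eq_iff indicator_def inj_image_mem_iff)
      then show ?thesis using de by (auto simp: \<Phi>_def)
    qed
    then show "p = q" using pq by (metis beta_nat_eqI)
  qed
  then have "embedding_map beta_nat (top_of_set compactification) \<Phi>"
    using cont' Hausdorff_compactification compact_beta_nat
    by (intro injective_closed_imp_embedding_map continuous_imp_closed_map)
  then have "beta_nat homeomorphic_space subtopology (top_of_set compactification) (\<Phi> ` topspace beta_nat)"
    unfolding embedding_map_def by (rule homeomorphic_map_imp_homeomorphic_space)
  moreover have "\<Phi> ` topspace beta_nat \<subseteq> topspace (top_of_set compactification)"
    using cont' by (rule continuous_map_image_subset_topspace)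
  ultimately show ?thesis
    unfolding contains_copy_of_def by (meson homeomorphic_space_sym)
qed

section \<open>The Josefson-Nissenzweig property\<close>

definition test_measure :: "nat \<Rightarrow> (((nat \<Rightarrow> real) \<Rightarrow> real) \<Rightarrow>\<^sub>0 real)" where
  "test_measure n = Abs_poly_mapping
     (\<lambda>p. if p = ideal_point then - 1 / 2 else if p \<in> point ` {..n} then 1 / (2 * Suc n) else 0)"

lemma lookup_test_measure:
  "Poly_Mapping.lookup (test_measure n) =
     (\<lambda>p. if p = ideal_point then - 1 / 2 else if p \<in> point ` {..n} then 1 / (2 * Suc n) else 0)"
  unfolding test_measure_def
  by (rule lookup_Abs_poly_mapping, rule finite_subset[of _ "insert ideal_point (point ` {..n})"]) auto

lemma keys_test_measure: "Poly_Mapping.keys (test_measure n) = insert ideal_point (point ` {..n})"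
  by (auto simp: in_keys_iff lookup_test_measure split: if_splits)

lemma sum_test_measure:
  "(\<Sum>p\<in>Poly_Mapping.keys (test_measure n). h (Poly_Mapping.lookup (test_measure n) p) p) =
     h (- 1 / 2) ideal_point + (\<Sum>k\<le>n. h (1 / (2 * Suc n)) (point k))"
proof -
  have "ideal_point \<notin> point ` {..n}" by (metis imageE point_neq_ideal_point)
  moreover have "inj_on point {..n}" by (simp add: inj_on_def)
  ultimately show ?thesis
    by (simp add: keys_test_measure lookup_test_measure sum.reindex)
qed

lemma norm_test_measure: "sm_norm (test_measure n) = 1"
  unfolding sm_norm_def sum_test_measure[where h = "\<lambda>a _. \<bar>a\<bar>"] by (simp add: field_simps)

lemma apply_test_measure:
  "sm_apply (test_measure n) g = (\<Sum>k\<le>n. g (point k) - g ideal_point) / (2 * Suc n)"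
  unfolding sm_apply_def sum_test_measure[where h = "\<lambda>a p. a * g p"]
  by (simp add: sum_subtractf sum_divide_distrib[symmetric] sum_distrib_left[symmetric] field_simps)

text \<open>
  A basic neighbourhood of the point at infinity restricts finitely many coordinates. The sets of
  density zero among them have a union of density zero, and a principal point outside this union
  agrees with the point at infinity on the restricted coordinates.
\<close>
lemma near_ideal_point:
  assumes g: "continuous_map (top_of_set compactification) euclideanreal g" and "0 < \<epsilon>"
  obtains A where "density_zero A" "\<And>k. k \<notin> A \<Longrightarrow> \<bar>g (point k) - g ideal_point\<bar> < \<epsilon>"
proof -
  let ?T = "product_topology (\<lambda>_::nat \<Rightarrow> real. euclideanreal) UNIV"
  have "openin (top_of_set compactification)
      {p \<in> compactification. g p \<in> ball (g ideal_point) \<epsilon>}"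
    using openin_continuous_map_preimage[OF g, of "ball (g ideal_point) \<epsilon>"] by simp
  then obtain U where U: "open U"
    "{p \<in> compactification. g p \<in> ball (g ideal_point) \<epsilon>} = compactification \<inter> U"
    unfolding openin_open by metis
  have "ideal_point \<in> {p \<in> compactification. g p \<in> ball (g ideal_point) \<epsilon>}" using \<open>0 < \<epsilon>\<close> by simp
  then have "ideal_point \<in> U" unfolding U(2) by simp
  moreover have "openin ?T U" using U(1) by (simp add: euclidean_product_topology)
  ultimately obtain X where X: "ideal_point \<in> PiE UNIV X" "finite {f. X f \<noteq> UNIV}" "PiE UNIV X \<subseteq> U"
    using product_topology_open_contains_basis[of "\<lambda>_. euclideanreal" UNIV U ideal_point] by auto
  define A where "A = (\<Union>f\<in>{f. X f \<noteq> UNIV \<and> (\<exists>A. density_zero A \<and> f = indicator A)}. {k. f k \<noteq> 0})"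
  have "density_zero A"
    unfolding A_def
  proof (rule density_zero_UN)
    show "finite {f. X f \<noteq> UNIV \<and> (\<exists>A. density_zero A \<and> f = indicator A)}"
      by (rule finite_subset[OF _ X(2)]) auto
    fix f :: "nat \<Rightarrow> real" assume "f \<in> {f. X f \<noteq> UNIV \<and> (\<exists>A. density_zero A \<and> f = indicator A)}"
    then obtain B where "density_zero B" "f = indicator B" by auto
    then show "density_zero {k. f k \<noteq> 0}" by (auto elim!: density_zero_subset simp: indicator_def)
  qed
  moreover have "\<bar>g (point k) - g ideal_point\<bar> < \<epsilon>" if "k \<notin> A" for k
  proof -
    have "point k f \<in> X f" for f
    proof (cases "X f = UNIV")
      case False
      then have "point k f = ideal_point f" using that by (auto simp: A_def point_def)
      also have "ideal_point f \<in> X f" using X(1) by (auto simp: PiE_def)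
      finally show ?thesis .
    qed auto
    then have "point k \<in> compactification \<inter> U" using X(3) by auto
    then have "g (point k) \<in> ball (g ideal_point) \<epsilon>" unfolding U(2)[symmetric] by simp
    then show ?thesis by (simp add: dist_real_def abs_minus_commute)
  qed
  ultimately show ?thesis by (rule that)
qed

text \<open>
  Outside a set \<open>A\<close> of density zero the terms of the average are small, and the terms in \<open>A\<close>
  contribute at most a bound of \<open>g\<close> times the density of \<open>A\<close> in \<open>{..n}\<close>.
\<close>
lemma test_measures_converge:
  assumes g: "continuous_map (top_of_set compactification) euclideanreal g"
  shows "(\<lambda>n. sm_apply (test_measure n) g) \<longlonglongrightarrow> 0"
proof (rule LIMSEQ_I)
  fix \<epsilon> :: real assume "0 < \<epsilon>"
  then obtain A where A: "density_zero A" "\<And>k. k \<notin> A \<Longrightarrow> \<bar>g (point k) - g ideal_point\<bar> < \<epsilon>"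
    using near_ideal_point[OF g] by metis
  have "compact (g ` compactification)"
    using g compact_compactification by (simp add: compact_continuous_image)
  then obtain M where M: "\<And>p. p \<in> compactification \<Longrightarrow> \<bar>g p\<bar> \<le> M"
    using compact_imp_bounded by (fastforce simp: bounded_iff)
  have M0: "0 \<le> M" using M[OF ideal_point_in] by linarith
  have split: "(a * \<epsilon> + 2 * M * c) / (2 * a) = \<epsilon> / 2 + M * (c / a)" if "a \<noteq> 0" for a c :: real
    using that by (simp add: field_simps)
  have bound: "\<bar>sm_apply (test_measure n) g\<bar> \<le> \<epsilon> / 2 + M * freq n A" for n
  proof -
    have "\<bar>\<Sum>k\<le>n. g (point k) - g ideal_point\<bar> \<le> (\<Sum>k\<le>n. \<bar>g (point k) - g ideal_point\<bar>)" by (rule sum_abs)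
    also have "\<dots> \<le> (\<Sum>k\<le>n. \<epsilon> + 2 * M * indicator A k)"
    proof (rule sum_mono)
      fix k
      show "\<bar>g (point k) - g ideal_point\<bar> \<le> \<epsilon> + 2 * M * indicator A k"
        using A(2)[of k] M[of "point k"] M[of ideal_point] \<open>0 < \<epsilon>\<close> by (cases "k \<in> A") auto
    qed
    also have "\<dots> = Suc n * \<epsilon> + 2 * M * (\<Sum>k\<le>n. indicator A k)"
      by (simp add: sum.distrib sum_distrib_left[symmetric])
    also have "(\<Sum>k\<le>n. indicator A k) = real (card (A \<inter> {..n}))"
      using sum.inter_restrict[of "{..n}" "\<lambda>_. 1::real" A]
      by (simp add: indicator_def of_bool_def Int_commute)
    finally have le: "\<bar>\<Sum>k\<le>n. g (point k) - g ideal_point\<bar>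
      \<le> Suc n * \<epsilon> + 2 * M * card (A \<inter> {..n})" .
    have "\<bar>sm_apply (test_measure n) g\<bar> = \<bar>\<Sum>k\<le>n. g (point k) - g ideal_point\<bar> / (2 * Suc n)"
      unfolding apply_test_measure abs_divide abs_of_nat ..
    also have "\<dots> \<le> (Suc n * \<epsilon> + 2 * M * card (A \<inter> {..n})) / (2 * Suc n)"
      by (rule divide_right_mono[OF le]) simp
    also have "\<dots> = \<epsilon> / 2 + M * freq n A"
      using split[of "Suc n" "card (A \<inter> {..n})"] by (simp add: freq_def)
    finally show ?thesis .
  qed
  have "(\<lambda>n. M * freq n A) \<longlonglongrightarrow> 0"
    using tendsto_mult_right_zero A(1) by (simp add: density_zero_def tendsto_mult_right_zero)
  then obtain N where N: "\<And>n. N \<le> n \<Longrightarrow> M * freq n A < \<epsilon> / 2"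
    using order_tendstoD(2)[of _ 0 sequentially "\<epsilon> / 2"] \<open>0 < \<epsilon>\<close> by (force simp: eventually_sequentially)
  then have "\<bar>sm_apply (test_measure n) g\<bar> < \<epsilon>" if "N \<le> n" for n
    using bound[of n] N[OF that] by linarith
  then show "\<exists>N. \<forall>n\<ge>N. norm (sm_apply (test_measure n) g - 0) < \<epsilon>" by auto
qed

lemma JNP_compactification: "Cp_JNP (top_of_set compactification)"
  unfolding Cp_JNP_def
proof (intro exI[of _ test_measure] conjI allI ballI)
  show "test_measure n \<in> sign_measures (top_of_set compactification)" for n
    by (auto simp: sign_measures_def keys_test_measure)
  show "sm_norm (test_measure n) = 1" for n by (rule norm_test_measure)
  show "(\<lambda>n. sm_apply (test_measure n) f) \<longlonglongrightarrow> 0" if "f \<in> topspace (Cp (top_of_set compactification))" for f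
    using that unfolding Cp_def topspace_subtopology by (intro test_measures_converge) blast
qed

theorem mainTheorem5:
  "\<exists>K :: ((nat \<Rightarrow> real) \<Rightarrow> real) topology.
     compact_space K \<and> Hausdorff_space K \<and>
     (\<not> has_nontrivial_convergent_sequence K \<and> contains_copy_of K beta_nat) \<and>
     Cp_JNP K"
  using compact_compactification Hausdorff_compactification no_convergent_sequence
    contains_beta_nat JNP_compactification
  by (intro exI[of _ "top_of_set compactification"]) (simp add: compact_space_subtopology)

end
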